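(* Let $n\ge1$ be odd. For every integer $k$ with $(n+1)/2\le k\le n$, $$\sum_{\nu=0}^{k}\binom{2k-\nu}{k}\binom{n}{\nu}\mathbf{B}_{n-\nu}=0.$$
   Context: $\mathbf{B}_n$ denotes the $n$-th Bernoulli number, defined by $\frac{t}{e^t-1}=\sum_{n\ge0}\mathbf{B}_n\frac{t^n}{n!}$ (so $\mathbf{B}_1=-\frac12$). *)

theory Defs
  imports "HOL-Computational_Algebra.Formal_Power_Series"
begin

(* The quotient is an exact one: numerator and denominator both have subdegree 1. *)
definition bernoulli_fps :: "rat fps" where
  "bernoulli_fps = fps_X / (fps_exp 1 - 1)"

(* Convention of t / (e^t - 1), so bernoulli 1 = - 1/2. *)
definition bernoulli :: "nat \<Rightarrow> rat" where
  "bernoulli n = fact n * fps_nth bernoulli_fps n"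

lemma bernoulli_generating_function:
  "Abs_fps (\<lambda>n. bernoulli n / fact n) * (fps_exp 1 - 1) = fps_X"
proof -
  have nz: "(fps_exp 1 - 1 :: rat fps) \<noteq> 0"
  proof
    assume "(fps_exp 1 - 1 :: rat fps) = 0"
    then have "fps_nth (fps_exp 1 - 1 :: rat fps) 1 = 0" by simp
    then show False by simp
  qed
  have sd: "subdegree (fps_exp 1 - 1 :: rat fps) = 1"
    by (rule subdegreeI) auto
  have "Abs_fps (\<lambda>n. bernoulli n / fact n) = bernoulli_fps"
    by (rule fps_ext) (simp add: bernoulli_def)
  moreover have "(fps_exp 1 - 1 :: rat fps) dvd fps_X"
    using nz sd by (simp add: fps_dvd_iff)
  ultimately show ?thesis
    by (simp add: bernoulli_fps_def)
qed

lemma bernoulli_0_1: "bernoulli 0 = 1" "bernoulli 1 = - 1 / 2"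
proof -
  let ?B = "Abs_fps (\<lambda>n. bernoulli n / fact n)"
  have "fps_nth (?B * (fps_exp 1 - 1)) 1 = 1" "fps_nth (?B * (fps_exp 1 - 1)) 2 = 0"
    by (simp_all only: bernoulli_generating_function) simp_all
  then show "bernoulli 0 = 1" "bernoulli 1 = - 1 / 2"
    by (simp_all add: fps_mult_nth numeral_2_eq_2)
qed

end

(* The sum is n! times the coefficient of s^n in f(s) s / (e^s - 1), where
   f(s) = sum over v of C(2k - v, k) s^v / v! is, up to normalisation, the numerator of the
   diagonal Pade approximant of e^s: e^s f(-s) agrees with f(s) up to order 2k.
   Since t / (e^t - 1) at t = -s is e^s s / (e^s - 1), the substitution s -> -s fixes the series
   f(s) s / (e^s - 1) up to order 2k, so its odd coefficients of index at most 2k vanish. *)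
theory Submission
  imports Defs
begin

text \<open>The sum is the m-th backward difference of N -> C(N, k). By Pascal's rule each
  difference lowers both arguments by one: C(N, k) - C(N - 1, k) = C(N - 1, k - 1). The bound m
  \<le> N keeps the subtraction on naturals exact.\<close>

lemma alternating_sum_binomial_shift:
  assumes "m \<le> N"
  shows "(\<Sum>i=0..m. (-1) ^ i * of_nat (m choose i) * of_nat ((N - i) choose k) :: 'a::comm_ring_1)
    = (if m \<le> k then of_nat ((N - m) choose (k - m)) else 0)"
  using assms
proof (induction m arbitrary: N)
  case 0
  then show ?case by simp
next
  case (Suc m)
  let ?D = "\<lambda>N. \<Sum>i=0..m. (-1) ^ i * of_nat (m choose i) * of_nat ((N - i) choose k) :: 'a"
  let ?g = "\<lambda>i. of_nat ((N - i) choose k) :: 'a"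
  have "(\<Sum>i=0..Suc m. (-1) ^ i * of_nat (Suc m choose i) * ?g i)
      = ?g 0 + (\<Sum>i=0..m. (-1) ^ Suc i * of_nat (Suc m choose Suc i) * ?g (Suc i))"
    by (subst sum.atLeast0_atMost_Suc_shift) simp
  also have "\<dots> = ?g 0 + (\<Sum>i=0..m. (-1) ^ Suc i * of_nat (m choose Suc i) * ?g (Suc i))
      - (\<Sum>i=0..m. (-1) ^ i * of_nat (m choose i) * ?g (Suc i))"
    by (simp add: algebra_simps sum.distrib sum_negf sum_subtractf)
  also have "?g 0 + (\<Sum>i=0..m. (-1) ^ Suc i * of_nat (m choose Suc i) * ?g (Suc i))
      = (\<Sum>i=0..Suc m. (-1) ^ i * of_nat (m choose i) * ?g i)"
    by (simp only: sum.atLeast0_atMost_Suc_shift) simp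
  also have "\<dots> = ?D N"
    by (simp add: binomial_eq_0)
  also have "(\<Sum>i=0..m. (-1) ^ i * of_nat (m choose i) * ?g (Suc i)) = ?D (N - 1)"
    by simp
  finally have rec: "(\<Sum>i=0..Suc m. (-1) ^ i * of_nat (Suc m choose i) * ?g i)
      = ?D N - ?D (N - 1)" .
  have IH: "?D N = (if m \<le> k then of_nat ((N - m) choose (k - m)) else 0)"
    "?D (N - 1) = (if m \<le> k then of_nat ((N - 1 - m) choose (k - m)) else 0)"
    by (rule Suc.IH, use Suc.prems in simp)+
  show ?case
  proof (cases "Suc m \<le> k")
    case True
    have "N - m = Suc (N - Suc m)" "k - m = Suc (k - Suc m)"
      using True Suc.prems by auto
    then show ?thesis
      using True unfolding rec IH by simp
  next
    case False
    \<comment> \<open>For m = k both differences equal 1 and cancel; for m > k both are already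
      0.\<close>
    then show ?thesis
      unfolding rec IH by (cases "m = k") auto
  qed
qed

text \<open>For k \<ge> 1 a polynomial of degree k, since 2k - i < k for every i > k, also under
  truncated subtraction.\<close>

definition pade_exp_numerator :: "nat \<Rightarrow> rat fps" where
  "pade_exp_numerator k = Abs_fps (\<lambda>i. of_nat ((2 * k - i) choose k) / fact i)"

text \<open>Multiplied by m!, the left coefficient is the m-th backward difference of C(N, k) at N =
  2k. For m \<le> k this is C(2k - m, k - m), which equals C(2k - m, k) by symmetry; for k < m \<le>
  2k both sides vanish.\<close>

lemma pade_exp_numerator_reflect:
  assumes "k \<ge> 1" "m \<le> 2 * k"
  shows "fps_nth (fps_compose (pade_exp_numerator k) (- fps_X) * fps_exp 1) m
    = fps_nth (pade_exp_numerator k) m"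
proof -
  have "fps_nth (fps_compose (pade_exp_numerator k) (- fps_X) * fps_exp 1) m
      = (\<Sum>i=0..m. (-1) ^ i * of_nat ((2 * k - i) choose k) / fact i / fact (m - i))"
    by (simp add: fps_mult_nth fps_compose_uminus' pade_exp_numerator_def)
  also have "\<dots> = (\<Sum>i=0..m. (-1) ^ i * of_nat (m choose i) * of_nat ((2 * k - i) choose k)) / fact m"
    unfolding sum_divide_distrib
    by (intro sum.cong) (auto simp: binomial_fact field_simps)
  also have "\<dots> = of_nat ((2 * k - m) choose k) / fact m"
  proof (cases "m \<le> k")
    case True
    then have "(2 * k - m) choose (k - m) = (2 * k - m) choose k"
      by (subst binomial_symmetric) auto
    with True show ?thesis
      using assms by (simp add: alternating_sum_binomial_shift)
  next
    case False
    then show ?thesis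
      using assms by (simp add: alternating_sum_binomial_shift)
  qed
  finally show ?thesis
    by (simp add: pade_exp_numerator_def)
qed

lemma bernoulli_fps_mult: "bernoulli_fps * (fps_exp 1 - 1) = fps_X"
proof -
  have "bernoulli_fps = Abs_fps (\<lambda>n. bernoulli n / fact n)"
    by (rule fps_ext) (simp add: bernoulli_def)
  then show ?thesis
    using bernoulli_generating_function by simp
qed

text \<open>Both sides give -t when multiplied by e^(-t) - 1, and this nonzero series can be
  cancelled.\<close>

lemma bernoulli_fps_reflect:
  "fps_compose bernoulli_fps (- fps_X) = bernoulli_fps * fps_exp 1"
proof -
  let ?B' = "fps_compose bernoulli_fps (- fps_X)"
  have E: "fps_exp 1 * fps_exp (-1) = (1 :: rat fps)"
    by (simp flip: fps_exp_add_mult)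
  have "?B' * (fps_exp (-1) - 1) = fps_compose (bernoulli_fps * (fps_exp 1 - 1)) (- fps_X)"
    by (simp add: fps_compose_mult_distrib fps_compose_sub_distrib)
  also have "\<dots> = - (bernoulli_fps * (fps_exp 1 - 1))"
    by (simp add: bernoulli_fps_mult)
  also have "\<dots> = bernoulli_fps * fps_exp 1 * (fps_exp (-1) - 1)"
    using E by (simp add: algebra_simps)
  finally have eq: "?B' * (fps_exp (-1) - 1) = bernoulli_fps * fps_exp 1 * (fps_exp (-1) - 1)" .
  have "fps_nth (fps_exp (-1) - 1 :: rat fps) 1 \<noteq> 0"
    by simp
  then have "(fps_exp (-1) - 1 :: rat fps) \<noteq> 0"
    by (metis fps_zero_nth)
  then show ?thesis
    using eq by simp
qed

theorem corollary5p7: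
  fixes n k :: nat
  assumes "n \<ge> 1" and "odd n" and "(n + 1) div 2 \<le> k" and "k \<le> n"
  shows "(\<Sum>\<nu> = 0..k. of_nat ((2 * k - \<nu>) choose k) * of_nat (n choose \<nu>) * bernoulli (n - \<nu>)) = 0"
proof -
  \<comment> \<open>Since n is odd, the division by 2 is exact.\<close>
  have k: "k \<ge> 1" "n \<le> 2 * k"
    using assms by (auto elim!: oddE)
  let ?f = "pade_exp_numerator k"
  let ?G = "?f * bernoulli_fps"
  have "- fps_nth ?G n = fps_nth (fps_compose ?G (- fps_X)) n"
    using assms(2) by (simp add: fps_compose_uminus')
  also have "fps_compose ?G (- fps_X)
      = fps_compose ?f (- fps_X) * fps_exp 1 * bernoulli_fps"
    by (simp add: fps_compose_mult_distrib bernoulli_fps_reflect mult_ac)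
  \<comment> \<open>Only coefficients of index at most n \<le> 2k of the first factor enter, and
    there the reflection of \<open>?f\<close> is exact.\<close>
  also have "fps_nth \<dots> n = fps_nth ?G n"
    unfolding fps_mult_nth[of _ bernoulli_fps]
    using k by (intro sum.cong) (auto simp: pade_exp_numerator_reflect)
  finally have G0: "fps_nth ?G n = 0"
    by simp
  have "(\<Sum>\<nu> = 0..k. of_nat ((2 * k - \<nu>) choose k) * of_nat (n choose \<nu>) * bernoulli (n - \<nu>))
      = (\<Sum>\<nu> = 0..n. of_nat ((2 * k - \<nu>) choose k) * of_nat (n choose \<nu>) * bernoulli (n - \<nu>))"
    \<comment> \<open>The added terms have k < \<nu> \<le> n, so 2k - \<nu> < k and the first
      binomial is 0.\<close>
    using assms(4) k by (intro sum.mono_neutral_left) auto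
  also have "\<dots> = fact n * fps_nth ?G n"
    unfolding fps_mult_nth sum_distrib_left
    by (intro sum.cong) (auto simp: pade_exp_numerator_def bernoulli_def binomial_fact field_simps)
  finally show ?thesis
    using G0 by simp
qed

end
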